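(* Let $q$ be a nonzero complex number with $q^3\neq 1$ and $q^4\neq 1$. Let $A,B$ be $4\times 4$ complex matrices such that $x\mapsto A$, $y\mapsto B$ is an admissible representation of the $q$-spinor $xy=qyx$, and suppose that $A$ is invertible. Then the representation $(A,B)$ is equivalent to a representation $(A_0,B_0)$ of one of the following three forms, where the matrix $B'$ listed with it satisfies $B'A_0=qA_0B'$, $B'B_0=qB_0B'$ and $B'B_0\neq 0$ (so $B'$ is a matrix showing that $(A_0,B_0)$ is admissible): 1. $A_0=\mathrm{diag}(q^2,q,q,1)$, $B_0=q e_{13}-\mu e_{24}$, $B'=e_{43}-\mu e_{21}$, for some $\mu\in\mathbb{C}$; 2. $A_0=\mathrm{diag}(q^2,q,q,1)$, $B_0=q e_{12}+\mu e_{34}$, $B'=e_{42}+\mu e_{31}$, for some $\mu\in\mathbb{C}$; 3. $A_0=\mathrm{diag}\left(\begin{pmatrix} q & 1\\ 0 & q\end{pmatrix},\,q^2,\,1\right)$ (block diagonal), $B_0$ is a linear combination of $B_1=e_{14}$ and $B_2=e_{32}$, and $B'$ is a linear combination of $B'_1=e_{13}$ and $B'_2=e_{42}$.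
   Context: All matrices are $4\times 4$ over $\mathbb{C}$, and $e_{ij}$ denotes the matrix unit with $1$ in position $(i,j)$ and $0$ elsewhere. A representation of the $q$-spinor $(x,y)$, $xy=qyx$, is a pair of matrices $(A,B)$, written $x\mapsto A$, $y\mapsto B$, such that $AB=qBA$. Two representations $(A,B)$ and $(\tilde A,\tilde B)$ of the $q$-spinor are equivalent if there exist an invertible $4\times 4$ complex matrix $u$ and a nonzero complex number $\alpha$ such that $\tilde A=\alpha\,uAu^{-1}$ and $\tilde B=\alpha\,uBu^{-1}$. A representation $x\mapsto A$, $y\mapsto B$ of the $q$-spinor is called admissible if there exists a matrix $C$ such that $x\mapsto C$, $y\mapsto B$ and $x\mapsto C$, $y\mapsto A$ are also representations of the $q$-spinor (that is, $CB=qBC$ and $CA=qAC$) and $CB\neq 0$. *)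

theory Defs
  imports "HOL-Analysis.Analysis"
begin

text \<open>
  Matrices are elements of \<^typ>\<open>complex^4^4\<close>; \<open>M $ i $ j\<close> is the entry in row \<open>i\<close> and column \<open>j\<close>.
  The four elements of the index type \<^typ>\<open>4\<close> are written \<open>1, 2, 3, 4\<close>. Numerals of this type are
  read modulo 4, so \<open>4\<close> is the element that is also denoted \<open>0\<close>.
\<close>

lemma vector_4 [simp]:
  "vector [a, b, c, d] $ (1::4) = (a::'a::zero)"
  "vector [a, b, c, d] $ (2::4) = b"
  "vector [a, b, c, d] $ (3::4) = c"
  "vector [a, b, c, d] $ (4::4) = d"
  by (simp_all add: vector_def)

text \<open>The matrix unit: the row \<open>i\<close> is the \<open>j\<close>-th standard basis vector and all other rows vanish.\<close>

definition matrix_unit :: "4 \<Rightarrow> 4 \<Rightarrow> complex^4^4" where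
  "matrix_unit i j = axis i (axis j 1)"

definition diagonal :: "complex^4 \<Rightarrow> complex^4^4" where
  "diagonal d = (\<chi> i j. if i = j then d $ i else 0)"

text \<open>The operation \<^const>\<open>vector_scalar_mult\<close> would need a scalar in \<^typ>\<open>complex^4\<close> when applied to
  a matrix, and \<^const>\<open>scaleR\<close> a real one.\<close>

definition cscale :: "complex \<Rightarrow> complex^4^4 \<Rightarrow> complex^4^4" (infixr \<open>*\<^sub>C\<close> 75) where
  "c *\<^sub>C M = map_matrix ((*) c) M"

definition spinor_rep :: "complex \<Rightarrow> complex^4^4 \<Rightarrow> complex^4^4 \<Rightarrow> bool" where
  "spinor_rep q A B \<longleftrightarrow> A ** B = q *\<^sub>C (B ** A)"

definition equivalent_reps ::
  "(complex^4^4) \<times> (complex^4^4) \<Rightarrow> (complex^4^4) \<times> (complex^4^4) \<Rightarrow> bool" where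
  "equivalent_reps = (\<lambda>(A, B) (A', B').
     \<exists>u \<alpha>. invertible u \<and> \<alpha> \<noteq> 0 \<and>
       A' = \<alpha> *\<^sub>C (u ** A ** matrix_inv u) \<and>
       B' = \<alpha> *\<^sub>C (u ** B ** matrix_inv u))"

definition admissibility_witness ::
  "complex \<Rightarrow> complex^4^4 \<Rightarrow> complex^4^4 \<Rightarrow> complex^4^4 \<Rightarrow> bool" where
  "admissibility_witness q A B C \<longleftrightarrow> spinor_rep q C B \<and> spinor_rep q C A \<and> C ** B \<noteq> 0"

definition admissible :: "complex \<Rightarrow> complex^4^4 \<Rightarrow> complex^4^4 \<Rightarrow> bool" where
  "admissible q A B \<longleftrightarrow> spinor_rep q A B \<and> (\<exists>C. admissibility_witness q A B C)"

definition form1 :: "complex \<Rightarrow> complex^4^4 \<Rightarrow> complex^4^4 \<Rightarrow> complex^4^4 \<Rightarrow> bool" where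
  "form1 q A\<^sub>0 B\<^sub>0 B' \<longleftrightarrow> (\<exists>\<mu>.
     A\<^sub>0 = diagonal (vector [q^2, q, q, 1]) \<and>
     B\<^sub>0 = q *\<^sub>C matrix_unit 1 3 - \<mu> *\<^sub>C matrix_unit 2 4 \<and>
     B' = matrix_unit 4 3 - \<mu> *\<^sub>C matrix_unit 2 1)"

definition form2 :: "complex \<Rightarrow> complex^4^4 \<Rightarrow> complex^4^4 \<Rightarrow> complex^4^4 \<Rightarrow> bool" where
  "form2 q A\<^sub>0 B\<^sub>0 B' \<longleftrightarrow> (\<exists>\<mu>.
     A\<^sub>0 = diagonal (vector [q^2, q, q, 1]) \<and>
     B\<^sub>0 = q *\<^sub>C matrix_unit 1 2 + \<mu> *\<^sub>C matrix_unit 3 4 \<and>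
     B' = matrix_unit 4 2 + \<mu> *\<^sub>C matrix_unit 3 1)"

definition form3 :: "complex \<Rightarrow> complex^4^4 \<Rightarrow> complex^4^4 \<Rightarrow> complex^4^4 \<Rightarrow> bool" where
  "form3 q A\<^sub>0 B\<^sub>0 B' \<longleftrightarrow>
     A\<^sub>0 = vector [vector [q, 1, 0,   0],
                  vector [0, q, 0,   0],
                  vector [0, 0, q^2, 0],
                  vector [0, 0, 0,   1]] \<and>
     (\<exists>b\<^sub>1 b\<^sub>2. B\<^sub>0 = b\<^sub>1 *\<^sub>C matrix_unit 1 4 + b\<^sub>2 *\<^sub>C matrix_unit 3 2) \<and>
     (\<exists>c\<^sub>1 c\<^sub>2. B' = c\<^sub>1 *\<^sub>C matrix_unit 1 3 + c\<^sub>2 *\<^sub>C matrix_unit 4 2)"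

end

theory Submission
  imports Defs "HOL-Computational_Algebra.Fundamental_Theorem_Algebra"
begin

text \<open>
  Let \<open>C\<close> witness admissibility. The relations say that \<open>B\<close> multiplies eigenvalues of \<open>A\<close> by \<open>q\<close> and that
  \<open>C\<close> divides them by \<open>q\<close>, so \<open>M = C B\<close> commutes with \<open>A\<close>. As at most four of the distinct numbers
  \<open>l, q l, \<dots>, q\<^sup>4 l\<close> are eigenvalues of \<open>A\<close>, no eigenvector of \<open>A\<close> is an eigenvector of \<open>M\<close> for a nonzero
  eigenvalue. If \<open>M v \<noteq> 0\<close> for some eigenvector \<open>v\<close> of \<open>A\<close>, then \<open>B v, M v, v, C v\<close> is a basis and, suitably
  scaled, it yields the first form. (The second form is the first one, with \<open>-\<mu>\<close> for \<open>\<mu>\<close>,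
  after swapping the two middle basis vectors, hence it never needs to be produced.)
  Otherwise \<open>A\<close> has an eigenvector \<open>f = M z\<close>, and also eigenvectors for the two
  neighbouring eigenvalues. Together with \<open>z\<close> they form a basis, because \<open>M\<close> kills all of them but not
  \<open>z\<close>, and in it \<open>A\<close> takes the Jordan form of the third case. The shape of \<open>B\<close> and \<open>C\<close> then
  follows from comparing matrix entries.
\<close>

subsection \<open>Eigenvectors\<close>

text \<open>Applying \<open>A - m\<close>, with \<open>m\<close> the first eigenvalue, to the
  vanishing sum deletes the first vector and rescales every other one by a nonzero factor
  \<open>l - m\<close>, which leaves a shorter list. The vectors may be zero, so arbitrary multiples
  of eigenvectors can be listed.\<close>

lemma sum_eigenvectors_eq_0:
  fixes A :: "'a::field^'n^'n"
  assumes "distinct (map fst ws)"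
    and "\<And>l w. (l, w) \<in> set ws \<Longrightarrow> A *v w = l *s w"
    and "sum_list (map snd ws) = 0"
  shows "\<forall>w \<in> set (map snd ws). w = 0"
  using assms
proof (induction "length ws" arbitrary: ws)
  case 0
  then show ?case by simp
next
  case (Suc n)
  then obtain m x us where ws: "ws = (m, x) # us" "length us = n"
    by (metis Suc_length_conv surj_pair)
  \<comment> \<open>These are the images of the remaining vectors under \<open>A - m\<close>. Their
    sum is the image of \<open>- x\<close>, hence zero.\<close>
  define vs where "vs = map (\<lambda>(l, w). (l, (l - m) *s w)) us"
  have sum: "sum_list (map snd vs) = A *v sum_list (map snd us) - m *s sum_list (map snd us)"
    if "\<And>l w. (l, w) \<in> set us \<Longrightarrow> A *v w = l *s w"
    using that unfolding vs_def
  proof (induction us)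
    case (Cons y us)
    obtain l w where y: "y = (l, w)"
      by (cases y)
    have IH: "sum_list (map (\<lambda>a. snd (case a of (l, w) \<Rightarrow> (l, l *s w - m *s w))) us) =
        A *v sum_list (map snd us) - m *s sum_list (map snd us)"
      using Cons by (simp add: comp_def vec.scale_left_diff_distrib)
    have "A *v w = l *s w"
      using Cons.prems y by simp
    with y show ?case
      by (simp add: IH comp_def vec.add vec.scale_right_distrib vec.scale_left_diff_distrib)
  qed simp
  have x: "sum_list (map snd us) = - x"
    using Suc.prems(3) ws by (simp add: eq_neg_iff_add_eq_0 add.commute)
  have Ax: "A *v x = m *s x"
    using Suc.prems(2) ws by simp
  have "sum_list (map snd vs) = 0"
    using sum Suc.prems(2) Ax unfolding x by (simp add: ws vec.scale_minus_right vec.neg)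
  moreover have "distinct (map fst vs)"
    using Suc.prems(1) ws(1) by (simp add: vs_def comp_def case_prod_beta)
  moreover have "A *v w = l *s w" if lw: "(l, w) \<in> set vs" for l w
  proof -
    obtain y where y: "(l, y) \<in> set us" "w = (l - m) *s y"
      using lw by (auto simp: vs_def)
    then have "A *v y = l *s y"
      using Suc.prems(2) ws(1) by simp
    then show ?thesis
      by (simp add: y(2) vec.scale vec.diff vec.scale_right_diff_distrib mult.commute)
  qed
  moreover have "n = length vs"
    using ws(2) by (simp add: vs_def)
  ultimately have vs: "\<forall>w \<in> set (map snd vs). w = 0"
    using Suc.hyps(1)[of vs] by blast
  have "w = 0" if "(l, w) \<in> set us" for l w
  proof -
    have "(l - m) *s w \<in> set (map snd vs)"
      using that by (force simp: vs_def image_iff)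
    moreover have "l \<noteq> m"
      using that Suc.prems(1) ws(1) by (auto simp: image_iff)
    ultimately show ?thesis
      using vs by (metis eq_iff_diff_eq_0 vec.scale_eq_0_iff)
  qed
  then have "\<forall>w \<in> set (map snd us). w = 0"
    by auto
  moreover from this have "sum_list (map snd us) = 0"
    by (induction us) auto
  ultimately show ?case
    using x ws(1) by simp
qed

section \<open>Polynomials in a matrix, and eigenvectors in invariant subspaces\<close>

definition apply_poly :: "'a::field^'n^'n \<Rightarrow> 'a poly \<Rightarrow> 'a^'n \<Rightarrow> 'a^'n" where
  "apply_poly A p v = fold_coeffs (\<lambda>a u. a *s v + A *v u) p 0"

lemma apply_poly_0 [simp]: "apply_poly A 0 v = 0"
  by (simp add: apply_poly_def)

lemma apply_poly_pCons [simp]: "apply_poly A (pCons a p) v = a *s v + A *v apply_poly A p v"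
  by (cases "p = 0 \<and> a = 0") (auto simp: apply_poly_def)

lemma apply_poly_add: "apply_poly A (p + r) v = apply_poly A p v + apply_poly A r v"
  by (induction p r rule: poly_induct2)
    (auto simp: matrix_vector_right_distrib vec.scale_left_distrib)

lemma apply_poly_smult: "apply_poly A (smult c p) v = c *s apply_poly A p v"
  by (induction p) (auto simp: vec.scale vec.scale_right_distrib)

lemma apply_poly_sum: "apply_poly A (sum f I) v = (\<Sum>i\<in>I. apply_poly A (f i) v)"
  by (induction I rule: infinite_finite_induct) (auto simp: apply_poly_add)

lemma apply_poly_monom: "apply_poly A (monom c i) v = c *s (((*v) A) ^^ i) v"
  by (induction i) (auto simp: monom_0 monom_Suc vec.scale)

lemma apply_poly_in_subspace:
  assumes "vec.subspace W" "\<And>w. w \<in> W \<Longrightarrow> A *v w \<in> W" "v \<in> W"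
  shows "apply_poly A p v \<in> W"
  by (induction p) (auto simp: assms vec.subspace_0 vec.subspace_add vec.subspace_scale)

text \<open>The iterates of \<open>v\<close> with exponents 0 to \<open>CARD('n)\<close> number one
  more than the dimension, so a linear relation among them gives \<open>p\<close>. Coinciding
  iterates are treated apart, because dependence of a set ignores repetitions.\<close>

lemma annihilating_poly:
  fixes A :: "'a::field^'n^'n"
  obtains p where "p \<noteq> 0" "apply_poly A p v = 0"
proof -
  define g where "g i = (((*v) A) ^^ i) v" for i
  show ?thesis
  proof (cases "inj_on g {..CARD('n)}")
    case False
    then obtain i j where "i \<noteq> j" "g i = g j"
      by (auto simp: inj_on_def)
    then have "apply_poly A (monom 1 i + monom (- 1) j) v = 0"
      by (simp add: apply_poly_add apply_poly_monom g_def vec.scale_minus_left)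
    moreover have "coeff (monom 1 i + monom (- 1) j) i \<noteq> (0 :: 'a)"
      using \<open>i \<noteq> j\<close> by simp
    ultimately show ?thesis
      by (metis coeff_0 that)
  next
    case True
    have "vec.dependent (g ` {..CARD('n)})"
      using True vec.independent_card_le_dim[of "g ` {..CARD('n)}" UNIV]
    by (auto simp: card_image card_cart_basis)
    then obtain u where u: "\<exists>w \<in> g ` {..CARD('n)}. u w \<noteq> 0" "(\<Sum>w \<in> g ` {..CARD('n)}. u w *s w) = 0"
      by (auto simp: vec.dependent_finite)
    define p where "p = (\<Sum>i\<le>CARD('n). monom (u (g i)) i)"
    have "apply_poly A p v = 0"
      using u(2) True by (simp add: p_def apply_poly_sum apply_poly_monom sum.reindex flip: g_def)
    moreover have "p \<noteq> 0"
    proof -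
      obtain i where "i \<le> CARD('n)" "u (g i) \<noteq> 0"
        using u(1) by auto
      then have "coeff p i \<noteq> 0"
        by (simp add: p_def coeff_sum)
      then show ?thesis by auto
    qed
    ultimately show ?thesis
      using that by blast
  qed
qed

text \<open>Roots are split off an annihilating polynomial: if \<open>p = [:- l, 1:] * r\<close>,
  then \<open>apply_poly A r v\<close> is either an eigenvector for \<open>l\<close> or zero, and in
  the latter case \<open>r\<close> annihilates \<open>v\<close> with smaller degree. Invariance
  keeps the vector inside \<open>W\<close>.\<close>

lemma eigenvector_in_subspace:
  fixes A :: "complex^'n^'n"
  assumes W: "vec.subspace W" "\<And>w. w \<in> W \<Longrightarrow> A *v w \<in> W" and v: "v \<in> W" "v \<noteq> 0"
  obtains l w where "w \<in> W" "w \<noteq> 0" "A *v w = l *s w"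
proof -
  obtain p where "p \<noteq> 0" "apply_poly A p v = 0"
    by (rule annihilating_poly)
  then have "\<exists>l w. w \<in> W \<and> w \<noteq> 0 \<and> A *v w = l *s w"
  proof (induction "degree p" arbitrary: p rule: less_induct)
    case less
    show ?case
    proof (cases "degree p = 0")
      case True
      then obtain a where "p = [:a:]"
        by (rule degree_eq_zeroE)
      then show ?thesis
        using less.prems v(2) by simp
    next
      case False
      then obtain l where "poly p l = 0"
        using fundamental_theorem_of_algebra by (metis constant_degree)
      then obtain r where p: "p = [:- l, 1:] * r"
        by (auto simp: poly_eq_0_iff_dvd)
      have r: "r \<noteq> 0" "degree r < degree p"
        using less.prems(1) p by (auto simp: degree_mult_eq simp del: mult_pCons_left)
      have "A *v apply_poly A r v = l *s apply_poly A r v"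
        using less.prems(2) unfolding p mult_pCons_left
        by (simp add: apply_poly_add apply_poly_smult vec.scale_minus_left
            del: smult_minus_left)
      then show ?thesis
        using less.hyps[OF r(2) r(1)] apply_poly_in_subspace[OF W v(1)] by blast
    qed
  qed
  then show ?thesis
    using that by blast
qed

text \<open>The hypothesis says that \<open>X (A - k l) = k (A - l) X\<close>. If \<open>A - k l\<close> were injective, it would map
  the kernel of \<open>X\<close> onto itself; as it maps \<open>s\<close> into that kernel, \<open>s\<close> would lie in it.\<close>

lemma intertwined_eigenvalue:
  fixes A X :: "'a::field^'n^'n"
  assumes X: "\<And>v. X *v (A *v v) = k *s (A *v (X *v v))"
    and s: "X *v s \<noteq> 0" "A *v (X *v s) = l *s (X *v s)"
  obtains w where "w \<noteq> 0" "A *v w = (k * l) *s w"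
proof -
  define D where "D v = A *v v - (k * l) *s v" for v
  have lin: "Vector_Spaces.linear (*s) (*s) D"
    unfolding D_def
    by (intro vec.linear_compose_sub vec.linear_scale_self) simp
  define K where "K = {v. X *v v = 0}"
  have K: "vec.subspace K"
    by (auto simp: K_def vec.subspace_def vec.add vec.scale)
  have XD: "X *v D v = k *s (A *v (X *v v) - l *s (X *v v))" for v
    by (simp add: D_def vec.diff vec.scale X vec.scale_right_diff_distrib)
  have "\<exists>w. w \<noteq> 0 \<and> D w = 0"
  proof (rule ccontr)
    assume *: "\<not> ?thesis"
    then have inj: "inj D"
      using vec.linear_inj_iff_eq_0[OF lin] by blast
    have "D ` K \<subseteq> K"
      by (auto simp: K_def XD)
    moreover have "vec.dim (D ` K) = vec.dim K"
      using lin inj by (intro vec.dim_image_eq) (auto intro: inj_on_subset)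
    ultimately have "D ` K = K"
      using K lin by (intro vec.subspace_dim_equal) (auto intro: vec.linear_subspace_image)
    moreover have "D s \<in> K"
      using s(2) by (simp add: K_def XD)
    ultimately have "s \<in> K"
      using inj by (metis imageE injD)
    then show False
      using s(1) by (simp add: K_def)
  qed
  then show ?thesis
    using that by (auto simp: D_def)
qed

subsection \<open>Change of basis\<close>

lemma cscale_nth [simp]: "(c *\<^sub>C M) $ i $ j = c * M $ i $ j"
  by (simp add: cscale_def map_matrix_def)

lemma cscale_mult_vec: "(c *\<^sub>C M) *v v = c *s (M *v v)"
  by (simp add: vec_eq_iff matrix_vector_mult_def sum_distrib_left mult.assoc)

lemma cscale_matrix_mult: "(c *\<^sub>C M) ** N = c *\<^sub>C (M ** N)"
  by (simp add: vec_eq_iff matrix_matrix_mult_def sum_distrib_left mult.assoc)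

lemma matrix_mult_cscale: "M ** (c *\<^sub>C N) = c *\<^sub>C (M ** N)"
  by (simp add: vec_eq_iff matrix_matrix_mult_def sum_distrib_left mult.left_commute)

lemma cscale_cscale: "a *\<^sub>C b *\<^sub>C M = (a * b) *\<^sub>C M"
  by (simp add: vec_eq_iff mult.assoc)

lemma matrix_inv_mult:
  fixes P :: "'a::semiring_1^'n^'m"
  assumes "invertible P"
  shows "matrix_inv P ** P = mat 1" "P ** matrix_inv P = mat 1"
  using someI_ex[of "\<lambda>Q. P ** Q = mat 1 \<and> Q ** P = mat 1"] assms
  by (simp_all add: matrix_inv_def invertible_def)

lemma spinor_rep_apply: "spinor_rep q X Y \<Longrightarrow> X *v (Y *v v) = q *s (Y *v (X *v v))"
  by (simp add: spinor_rep_def matrix_vector_mul_assoc cscale_mult_vec)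

lemma transpose_vector_mult:
  fixes a b c d :: "complex^4"
  shows "transpose (vector [a, b, c, d]) *v (x :: complex^4) = x$1 *s a + x$2 *s b + x$3 *s c + x$4 *s d"
  by (simp add: vec_eq_iff matrix_vector_mult_def transpose_def sum_4 mult.commute)

text \<open>\<open>vector\<close> lists rows; the transpose has the four vectors as columns and is
  thus the change-of-basis matrix.\<close>

definition basis4 :: "complex^4 \<Rightarrow> complex^4 \<Rightarrow> complex^4 \<Rightarrow> complex^4 \<Rightarrow> bool" where
  "basis4 a b c d \<longleftrightarrow> invertible (transpose (vector [a, b, c, d]) :: complex^4^4)"

lemma basis4I:
  assumes "\<And>x y z w. x *s a + y *s b + z *s c + w *s d = 0 \<Longrightarrow> x = 0 \<and> y = 0 \<and> z = 0 \<and> w = 0"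
  shows "basis4 a b c d"
  unfolding basis4_def invertible_left_inverse matrix_left_invertible_ker
proof (intro allI impI)
  fix x :: "complex^4" assume "transpose (vector [a, b, c, d]) *v x = (0 :: complex^4)"
  from assms[OF this[unfolded transpose_vector_mult]] show "x = 0"
    by (simp add: vec_eq_iff forall_4)
qed

lemma basis4_expand:
  assumes "basis4 a b c d"
  obtains x y z w where "v = x *s a + y *s b + z *s c + w *s d"
proof -
  obtain u :: "complex^4" where "transpose (vector [a, b, c, d]) *v u = v"
    using assms unfolding basis4_def invertible_right_inverse
    by (metis matrix_vector_mul_assoc matrix_vector_mul_lid)
  then show ?thesis
    using that by (metis transpose_vector_mult)
qed

text \<open>Column \<open>j\<close> of \<open>M\<close> holds the coordinates of \<alpha> times the
  image of the \<open>j\<close>-th basis vector, so the hypotheses are the columns of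
  \<open>\<alpha> *\<^sub>C (A ** P) = P ** M\<close>.\<close>

lemma basis4_conj:
  assumes "basis4 a b c d"
  defines "P \<equiv> transpose (vector [a, b, c, d]) :: complex^4^4"
  assumes "\<alpha> *s (A *v a) = M$1$1 *s a + M$2$1 *s b + M$3$1 *s c + M$4$1 *s d"
    and "\<alpha> *s (A *v b) = M$1$2 *s a + M$2$2 *s b + M$3$2 *s c + M$4$2 *s d"
    and "\<alpha> *s (A *v c) = M$1$3 *s a + M$2$3 *s b + M$3$3 *s c + M$4$3 *s d"
    and "\<alpha> *s (A *v d) = M$1$4 *s a + M$2$4 *s b + M$3$4 *s c + M$4$4 *s d"
  shows "M = \<alpha> *\<^sub>C (matrix_inv P ** A ** P)"
proof -
  have inv: "matrix_inv P ** P = mat 1"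
    using assms(1) by (simp add: basis4_def P_def matrix_inv_mult)
  have AP: "\<alpha> *\<^sub>C (A ** P) = P ** M"
  proof -
    define V where "V = (vector [a, b, c, d] :: complex^4^4)"
    have "\<alpha> *s (A *v V$j) = M$1$j *s a + M$2$j *s b + M$3$j *s c + M$4$j *s d" for j
      using assms(3-6) exhaust_4[of j] by (auto simp: V_def)
    moreover have "(\<alpha> *\<^sub>C (A ** P))$i$j = (\<alpha> *s (A *v V$j))$i" for i j
      by (simp add: P_def V_def transpose_def matrix_matrix_mult_def matrix_vector_mult_def)
    moreover have "(P ** M)$i$j = (M$1$j *s a + M$2$j *s b + M$3$j *s c + M$4$j *s d)$i" for i j
      by (simp add: P_def transpose_def matrix_matrix_mult_def sum_4)
    ultimately show ?thesis
      by (simp add: vec_eq_iff)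
  qed
  have "\<alpha> *\<^sub>C (matrix_inv P ** A ** P) = matrix_inv P ** (\<alpha> *\<^sub>C (A ** P))"
    by (simp add: matrix_mult_cscale matrix_mul_assoc)
  also have "\<dots> = M"
    by (simp add: AP matrix_mul_assoc inv)
  finally show ?thesis ..
qed

text \<open>The conjugating matrix in \<open>equivalent_reps\<close> is the inverse of the basis
  matrix \<open>P\<close>.\<close>

lemma equivalent_reps_conj:
  assumes "invertible P" "\<alpha> \<noteq> 0"
  shows "equivalent_reps (A, B) (\<alpha> *\<^sub>C (matrix_inv P ** A ** P), \<alpha> *\<^sub>C (matrix_inv P ** B ** P))"
proof -
  have P: "matrix_inv P ** P = mat 1" "P ** matrix_inv P = mat 1"
    using assms(1) by (simp_all add: matrix_inv_mult)
  then have "matrix_inv (matrix_inv P) = P"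
    by (metis invertible_def matrix_inv_mult matrix_mul_assoc matrix_mul_lid matrix_mul_rid)
  moreover have "invertible (matrix_inv P)"
    using P invertible_def by blast
  ultimately show ?thesis
    using assms(2) by (auto simp: equivalent_reps_def intro!: exI[of _ "matrix_inv P"] exI[of _ \<alpha>])
qed

lemma conj_mult:
  fixes P :: "complex^4^4"
  assumes "invertible P"
  shows "(\<alpha> *\<^sub>C (matrix_inv P ** X ** P)) ** (\<alpha> *\<^sub>C (matrix_inv P ** Y ** P)) =
    (\<alpha> * \<alpha>) *\<^sub>C (matrix_inv P ** (X ** Y) ** P)"
proof -
  have "matrix_inv P ** X ** P ** (matrix_inv P ** Y ** P) =
      matrix_inv P ** X ** (P ** matrix_inv P) ** Y ** P"
    by (simp add: matrix_mul_assoc)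
  then show ?thesis
    using assms
    by (simp add: cscale_matrix_mult matrix_mult_cscale cscale_cscale matrix_inv_mult matrix_mul_assoc)
qed

lemma spinor_rep_conj:
  assumes "invertible P" "spinor_rep q X Y"
  shows "spinor_rep q (\<alpha> *\<^sub>C (matrix_inv P ** X ** P)) (\<alpha> *\<^sub>C (matrix_inv P ** Y ** P))"
  using assms(2) unfolding spinor_rep_def conj_mult[OF assms(1)]
  by (simp add: cscale_matrix_mult matrix_mult_cscale cscale_cscale mult_ac)

text \<open>Both sides of each relation pick up the factor \<open>\<alpha> * \<alpha>\<close>, and
  undoing the conjugation shows that the product stays nonzero.\<close>

lemma admissibility_witness_conj:
  assumes P: "invertible P" and "\<alpha> \<noteq> 0" and "admissibility_witness q A B C"
  shows "admissibility_witness q (\<alpha> *\<^sub>C (matrix_inv P ** A ** P)) (\<alpha> *\<^sub>C (matrix_inv P ** B ** P))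
    (\<alpha> *\<^sub>C (matrix_inv P ** C ** P))"
proof -
  have "C ** B = 0" if "(\<alpha> * \<alpha>) *\<^sub>C (matrix_inv P ** (C ** B) ** P) = 0"
  proof -
    have "matrix_inv P ** (C ** B) ** P = 0"
      using that \<open>\<alpha> \<noteq> 0\<close> by (simp add: vec_eq_iff)
    then have "P ** (matrix_inv P ** (C ** B) ** P) ** matrix_inv P = 0"
      by simp
    moreover have "P ** (matrix_inv P ** (C ** B) ** P) ** matrix_inv P =
        (P ** matrix_inv P) ** (C ** B) ** (P ** matrix_inv P)"
      by (simp add: matrix_mul_assoc)
    ultimately show ?thesis
      using P by (simp add: matrix_inv_mult)
  qed
  then show ?thesis
    using assms spinor_rep_conj[OF P] by (auto simp: admissibility_witness_def conj_mult)
qed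

subsection \<open>The normal forms\<close>

definition jordan_matrix :: "complex \<Rightarrow> complex^4^4" where
  "jordan_matrix q = vector [vector [q, 1, 0,   0],
                            vector [0, q, 0,   0],
                            vector [0, 0, q^2, 0],
                            vector [0, 0, 0,   1]]"

lemma jordan_matrix_mult:
  "(jordan_matrix q ** B) $ 1 $ j = q * B$1$j + B$2$j"
  "(jordan_matrix q ** B) $ 2 $ j = q * B$2$j"
  "(jordan_matrix q ** B) $ 3 $ j = q^2 * B$3$j"
  "(jordan_matrix q ** B) $ 4 $ j = B$4$j"
  by (simp_all add: jordan_matrix_def matrix_matrix_mult_def sum_4)

lemma mult_jordan_matrix:
  "(B ** jordan_matrix q) $ i $ 1 = q * B$i$1"
  "(B ** jordan_matrix q) $ i $ 2 = B$i$1 + q * B$i$2"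
  "(B ** jordan_matrix q) $ i $ 3 = q^2 * B$i$3"
  "(B ** jordan_matrix q) $ i $ 4 = B$i$4"
  by (simp_all add: jordan_matrix_def matrix_matrix_mult_def sum_4 mult.commute)

text \<open>With diagonal entries \<open>d = (q, q, q^2, 1)\<close>, an entry \<open>(i, j)\<close>
  can survive only if \<open>d_i = q d_j\<close>, that is at (1,4), (2,4), (3,1) and (3,2). The
  off-diagonal 1 of the Jordan block then removes (2,4) and (3,1).\<close>

lemma spinor_rep_jordan:
  assumes "q \<noteq> 0" "q^2 \<noteq> 1" "q^3 \<noteq> 1" and "spinor_rep q (jordan_matrix q) B"
  shows "B = B$1$4 *\<^sub>C matrix_unit 1 4 + B$3$2 *\<^sub>C matrix_unit 3 2"
proof -
  have q: "q \<noteq> 1" "q * q \<noteq> 1" "q * (q * q) \<noteq> 1"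
    using assms by (auto simp: power2_eq_square power3_eq_cube mult.assoc)
  have eq: "(jordan_matrix q ** B) $ i $ j = q * (B ** jordan_matrix q) $ i $ j" for i j
    using assms(4) by (simp add: spinor_rep_def)
  note eqs = jordan_matrix_mult mult_jordan_matrix power2_eq_square
  have "B$2$j = 0" for j
  proof -
    have "B$2$1 = 0"
      using eq[of 2 1] q \<open>q \<noteq> 0\<close> by (simp add: eqs)
    \<comment> \<open>Entry (2,4) of the relation is trivial; it is entry (1,4) that forces
      \<open>B$2$4 = 0\<close>.\<close>
    then show ?thesis
      using eq[of 2 2] eq[of 2 3] eq[of 1 4] q \<open>q \<noteq> 0\<close> exhaust_4[of j]
      by (auto simp: eqs)
  qed
  moreover have "B$1$1 = 0"
    using eq[of 1 1] q \<open>q \<noteq> 0\<close> calculation by (simp add: eqs)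
  moreover have "B$1$2 = 0" "B$1$3 = 0"
    using eq[of 1 2] eq[of 1 3] q \<open>q \<noteq> 0\<close> calculation by (simp_all add: eqs)
  moreover have "B$3$1 = 0" "B$3$3 = 0" "B$3$4 = 0"
    using eq[of 3 2] eq[of 3 3] eq[of 3 4] q \<open>q \<noteq> 0\<close> by (simp_all add: eqs algebra_simps)
  moreover have "B$4$1 = 0" "B$4$3 = 0" "B$4$4 = 0"
    using eq[of 4 1] eq[of 4 3] eq[of 4 4] q by (auto simp: eqs mult.assoc[symmetric])
  moreover have "B$4$2 = 0"
    using eq[of 4 2] q calculation by (auto simp: eqs mult.assoc[symmetric])
  ultimately show ?thesis
    by (simp add: vec_eq_iff forall_4 matrix_unit_def axis_def)
qed

text \<open>Now the condition is \<open>d_j = q d_i\<close>, which leaves (1,3), (2,3), (4,1) and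
  (4,2). Entries (1,3) and (4,2) of the relation remove (2,3) and (4,1) through the Jordan
  block.\<close>

lemma spinor_rep_jordan':
  assumes "q \<noteq> 0" "q^2 \<noteq> 1" "q^3 \<noteq> 1" and "spinor_rep q C (jordan_matrix q)"
  shows "C = C$1$3 *\<^sub>C matrix_unit 1 3 + C$4$2 *\<^sub>C matrix_unit 4 2"
proof -
  have q: "q \<noteq> 1" "q * q \<noteq> 1" "q * (q * q) \<noteq> 1"
    using assms by (auto simp: power2_eq_square power3_eq_cube mult.assoc)
  have eq: "(C ** jordan_matrix q) $ i $ j = q * (jordan_matrix q ** C) $ i $ j" for i j
    using assms(4) by (simp add: spinor_rep_def)
  note eqs = jordan_matrix_mult mult_jordan_matrix power2_eq_square
  have "C$i$1 = 0" for i
  proof -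
    have "C$2$1 = 0"
      using eq[of 2 1] q \<open>q \<noteq> 0\<close> by (simp add: eqs)
    then show ?thesis
      using eq[of 1 1] eq[of 3 1] eq[of 4 2] q \<open>q \<noteq> 0\<close> exhaust_4[of i]
      by (auto simp: eqs)
  qed
  moreover have "C$2$2 = 0" "C$2$3 = 0" "C$2$4 = 0"
    using eq[of 2 2] eq[of 1 3] eq[of 2 4] q \<open>q \<noteq> 0\<close> calculation
    by (auto simp: eqs mult.assoc[symmetric])
  moreover have "C$1$2 = 0" "C$1$4 = 0"
    using eq[of 1 2] eq[of 1 4] q \<open>q \<noteq> 0\<close> calculation by (auto simp: eqs mult.assoc[symmetric])
  moreover have "C$3$2 = 0" "C$3$3 = 0" "C$3$4 = 0"
    using eq[of 3 2] eq[of 3 3] eq[of 3 4] q \<open>q \<noteq> 0\<close> calculation by (auto simp: eqs mult.assoc[symmetric])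
  moreover have "C$4$3 = 0" "C$4$4 = 0"
    using eq[of 4 3] eq[of 4 4] q \<open>q \<noteq> 0\<close> by (auto simp: eqs mult.assoc[symmetric])
  ultimately show ?thesis
    by (simp add: vec_eq_iff forall_4 matrix_unit_def axis_def)
qed

text \<open>The product \<open>B' ** B\<^sub>0\<close> is the multiple \<open>- \<mu> * q\<close> of
  \<open>matrix_unit 2 3\<close>, nonzero because \<mu> and \<open>q\<close> are.\<close>

lemma form1_witness:
  fixes q \<mu> :: complex
  defines "A\<^sub>0 \<equiv> diagonal (vector [q^2, q, q, 1])"
    and "B\<^sub>0 \<equiv> q *\<^sub>C matrix_unit 1 3 - \<mu> *\<^sub>C matrix_unit 2 4"
    and "B' \<equiv> matrix_unit 4 3 - \<mu> *\<^sub>C matrix_unit 2 1"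
  assumes "q \<noteq> 0" "\<mu> \<noteq> 0"
  shows "spinor_rep q A\<^sub>0 B\<^sub>0" "admissibility_witness q A\<^sub>0 B\<^sub>0 B'"
  using assms(4,5)
  by (simp_all add: assms(1-3) spinor_rep_def admissibility_witness_def vec_eq_iff forall_4
      matrix_matrix_mult_def sum_4 matrix_unit_def axis_def diagonal_def power2_eq_square)

subsection \<open>Admissible triples\<close>

text \<open>\<open>C\<close> is a fixed candidate witness. That \<open>C ** B\<close> is nonzero
  enters separately in each case below, on an eigenvector or as a matrix.\<close>

locale spinor_triple =
  fixes q :: complex and A B C :: "complex^4^4"
  assumes q_nonzero: "q \<noteq> 0" and q3: "q^3 \<noteq> 1" and q4: "q^4 \<noteq> 1"
    and rep_AB: "spinor_rep q A B" and rep_CB: "spinor_rep q C B" and rep_CA: "spinor_rep q C A"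
    and invertible_A: "invertible A"
begin

lemmas AB = spinor_rep_apply[OF rep_AB]
  and CB = spinor_rep_apply[OF rep_CB]
  and CA = spinor_rep_apply[OF rep_CA]

section \<open>Eigenvalues of \<open>A\<close> and how \<open>B\<close> and \<open>C\<close> shift
  them\<close>

lemma q2: "q^2 \<noteq> 1"
  using q4 by (metis power_mult mult_2 numeral_Bit0 power_one)

lemma distinct_eigenvalues:
  assumes "l \<noteq> 0"
  shows "distinct [l, q * l, q * (q * l), q * (q * (q * l)), q * (q * (q * (q * l)))]"
proof -
  have "q \<noteq> 1" "q * q \<noteq> 1" "q * (q * q) \<noteq> 1" "q * (q * (q * q)) \<noteq> 1"
    using q2 q3 q4 by (auto simp: eval_nat_numeral)
  then have "l \<noteq> q * l" "l \<noteq> q * (q * l)" "l \<noteq> q * (q * (q * l))" "l \<noteq> q * (q * (q * (q * l)))"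
    using assms by (metis mult.assoc mult_cancel_right1)+
  then show ?thesis
    using q_nonzero by simp
qed

lemma eigenvalue_nonzero: "A *v v = l *s v \<Longrightarrow> v \<noteq> 0 \<Longrightarrow> l \<noteq> 0"
  using invertible_A unfolding invertible_left_inverse matrix_left_invertible_ker by auto

lemma eigenvector_B: "A *v v = l *s v \<Longrightarrow> A *v (B *v v) = (q * l) *s (B *v v)"
  by (simp add: AB vec.scale)

lemma eigenvector_C:
  assumes "A *v v = (q * l) *s v"
  shows "A *v (C *v v) = l *s (C *v v)"
proof -
  have "q *s (A *v (C *v v)) = q *s (l *s (C *v v))"
    using CA[of v] assms by (simp add: vec.scale)
  then show ?thesis
    using q_nonzero by (simp only: vec.scale_cancel_left) simp
qed

text \<open>If \<open>c\<close> were nonzero, applying \<open>B\<close> repeatedly to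
  \<open>v\<close> would never give zero, and the five vectors from \<open>v\<close> to its fourth
  image would be eigenvectors of \<open>A\<close> for distinct eigenvalues, in dimension 4.\<close>

lemma CB_nilpotent_on_eigenvectors:
  assumes v: "v \<noteq> 0" "A *v v = l *s v" and CBv: "C *v (B *v v) = c *s v"
  shows "c = 0"
proof (rule ccontr)
  assume "c \<noteq> 0"
  \<comment> \<open>\<open>B *v w\<close> is nonzero since \<open>C\<close> maps it to
    \<open>k *s w\<close>; moving \<open>C\<close> past the outer \<open>B\<close> multiplies the
    eigenvalue by \<open>q\<close>.\<close>
  have step: "B *v w \<noteq> 0 \<and> C *v (B *v (B *v w)) = (q * k) *s (B *v w) \<and> q * k \<noteq> 0"
    if "w \<noteq> 0 \<and> C *v (B *v w) = k *s w \<and> k \<noteq> 0" for w k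
    using that q_nonzero by (auto simp: CB[of "B *v w"] vec.scale)
  define v1 v2 v3 v4 where "v1 = B *v v" and "v2 = B *v v1" and "v3 = B *v v2" and "v4 = B *v v3"
  have 1: "v1 \<noteq> 0 \<and> C *v (B *v v1) = (q * c) *s v1 \<and> q * c \<noteq> 0"
    unfolding v1_def using v CBv \<open>c \<noteq> 0\<close> by (intro step) auto
  have 2: "v2 \<noteq> 0 \<and> C *v (B *v v2) = (q * (q * c)) *s v2 \<and> q * (q * c) \<noteq> 0"
    unfolding v2_def by (rule step[OF 1])
  have 3: "v3 \<noteq> 0 \<and> C *v (B *v v3) = (q * (q * (q * c))) *s v3 \<and> q * (q * (q * c)) \<noteq> 0"
    unfolding v3_def by (rule step[OF 2])
  have 4: "v4 \<noteq> 0"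
    using step[OF 3] unfolding v4_def by blast
  have e1: "A *v v1 = (q * l) *s v1"
    unfolding v1_def by (rule eigenvector_B[OF v(2)])
  have e2: "A *v v2 = (q * (q * l)) *s v2"
    unfolding v2_def by (rule eigenvector_B[OF e1])
  have e3: "A *v v3 = (q * (q * (q * l))) *s v3"
    unfolding v3_def by (rule eigenvector_B[OF e2])
  have e4: "A *v v4 = (q * (q * (q * (q * l)))) *s v4"
    unfolding v4_def by (rule eigenvector_B[OF e3])
  have dist: "distinct [l, q * l, q * (q * l), q * (q * (q * l)), q * (q * (q * (q * l)))]"
    by (intro distinct_eigenvalues eigenvalue_nonzero[OF v(2,1)])
  have indep: "a0 *s v = 0 \<and> a1 *s v1 = 0 \<and> a2 *s v2 = 0 \<and> a3 *s v3 = 0 \<and> a4 *s v4 = 0"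
    if "a0 *s v + a1 *s v1 + a2 *s v2 + a3 *s v3 + a4 *s v4 = 0" for a0 a1 a2 a3 a4
  proof -
    have "\<forall>w \<in> set (map snd [(l, a0 *s v), (q * l, a1 *s v1), (q * (q * l), a2 *s v2),
        (q * (q * (q * l)), a3 *s v3), (q * (q * (q * (q * l))), a4 *s v4)]). w = 0"
    proof (rule sum_eigenvectors_eq_0[where A = A])
      show "A *v w = k *s w" if "(k, w) \<in> set [(l, a0 *s v), (q * l, a1 *s v1), (q * (q * l), a2 *s v2),
          (q * (q * (q * l)), a3 *s v3), (q * (q * (q * (q * l))), a4 *s v4)]" for k w
        using that v(2) e1 e2 e3 e4 by (auto simp: vec.scale mult_ac)
    qed (use that dist in \<open>simp_all add: add.assoc\<close>)
    then show ?thesis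
      by (simp only: list.map snd_conv list.set ball_simps)
  qed
  have "basis4 v v1 v2 v3"
  proof (rule basis4I)
    fix x y z w assume "x *s v + y *s v1 + z *s v2 + w *s v3 = 0"
    then show "x = 0 \<and> y = 0 \<and> z = 0 \<and> w = 0"
      using indep[of x y z w 0] v(1) 1 2 3 by simp
  qed
  then obtain x y z w where "v4 = x *s v + y *s v1 + z *s v2 + w *s v3"
    by (rule basis4_expand)
  then have "x *s v + y *s v1 + z *s v2 + w *s v3 + (- 1) *s v4 = 0"
    by simp
  from indep[OF this] show False
    using 4 by simp
qed

lemma diagonalizable_case:
  assumes v: "A *v v = l *s v" and CBv: "C *v (B *v v) \<noteq> 0"
  shows "\<exists>A\<^sub>0 B\<^sub>0 B'. spinor_rep q A\<^sub>0 B\<^sub>0 \<and> equivalent_reps (A, B) (A\<^sub>0, B\<^sub>0) \<and>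
    admissibility_witness q A\<^sub>0 B\<^sub>0 B' \<and> form1 q A\<^sub>0 B\<^sub>0 B'"
proof -
  \<comment> \<open>\<open>m\<close> is the lowest of the eigenvalues that occur, belonging to
    \<open>C *v v\<close>.\<close>
  define m where "m = l / q"
  have Av: "A *v v = (q * m) *s v"
    using v q_nonzero by (simp add: m_def)
  define f s t where "f = C *v (B *v v)" and "s = B *v v" and "t = C *v v"
  have "f \<noteq> 0" "s \<noteq> 0" "v \<noteq> 0"
    using CBv by (auto simp: f_def s_def)
  have Bt: "q *s (B *v t) = f"
    by (simp add: t_def f_def CB)
  then have "t \<noteq> 0"
    using \<open>f \<noteq> 0\<close> by auto
  have "m \<noteq> 0"
    using eigenvalue_nonzero[OF Av \<open>v \<noteq> 0\<close>] by auto
  have As: "A *v s = (q * (q * m)) *s s"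
    unfolding s_def by (rule eigenvector_B[OF Av])
  have At: "A *v t = m *s t"
    unfolding t_def by (rule eigenvector_C[OF Av])
  have Af: "A *v f = (q * m) *s f"
    unfolding f_def s_def[symmetric] by (rule eigenvector_C[OF As])
  have ABs: "A *v (B *v s) = (q * (q * (q * m))) *s (B *v s)"
    by (rule eigenvector_B[OF As])
  \<comment> \<open>\<open>f\<close> and \<open>v\<close> share the eigenvalue \<open>q * m\<close>,
    so their independence has to come from \<open>CB_nilpotent_on_eigenvectors\<close>.\<close>
  have vf: "x = 0 \<and> y = 0" if "x *s f + y *s v = 0" for x y
  proof -
    have "x = 0"
    proof (rule ccontr)
      assume "x \<noteq> 0"
      then have "f = (- y / x) *s v"
        using that by (simp add: vec_eq_iff field_simps eq_neg_iff_add_eq_0)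
      then show False
        using CB_nilpotent_on_eigenvectors[OF \<open>v \<noteq> 0\<close> Av, of "- y / x"] \<open>f \<noteq> 0\<close> by (auto simp: f_def)
    qed
    then show ?thesis
      using that \<open>v \<noteq> 0\<close> by simp
  qed
  have indep: "x1 *s s = 0 \<and> (x2 *s f + x3 *s v) = 0 \<and> x4 *s t = 0 \<and> x5 *s (B *v s) = 0"
    if "x1 *s s + x2 *s f + x3 *s v + x4 *s t + x5 *s (B *v s) = 0" for x1 x2 x3 x4 x5
  proof -
    have "\<forall>w \<in> set (map snd [(q * (q * m), x1 *s s), (q * m, x2 *s f + x3 *s v), (m, x4 *s t),
        (q * (q * (q * m)), x5 *s (B *v s))]). w = 0"
    proof (rule sum_eigenvectors_eq_0[where A = A])
      show "A *v w = k *s w" if "(k, w) \<in> set [(q * (q * m), x1 *s s), (q * m, x2 *s f + x3 *s v),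
          (m, x4 *s t), (q * (q * (q * m)), x5 *s (B *v s))]" for k w
        using that As Af Av At ABs by (auto simp: vec.scale vec.add vec.scale_right_distrib mult_ac)
    qed (use that distinct_eigenvalues[OF \<open>m \<noteq> 0\<close>] in \<open>auto simp: add.assoc\<close>)
    then show ?thesis
      by (simp only: list.map snd_conv list.set ball_simps)
  qed
  have basis: "basis4 s f v t"
  proof (rule basis4I)
    fix x1 x2 x3 x4 assume "x1 *s s + x2 *s f + x3 *s v + x4 *s t = 0"
    then show "x1 = 0 \<and> x2 = 0 \<and> x3 = 0 \<and> x4 = 0"
      using indep[of x1 x2 x3 x4 0] vf[of x2 x3] \<open>s \<noteq> 0\<close> \<open>t \<noteq> 0\<close> by simp
  qed
  \<comment> \<open>\<open>B *v s\<close> would have the further eigenvalue \<open>q^3 m\<close>,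
    for which a basis of eigenvectors with other eigenvalues leaves no room.\<close>
  then obtain x1 x2 x3 x4 where "B *v s = x1 *s s + x2 *s f + x3 *s v + x4 *s t"
    by (rule basis4_expand)
  then have "x1 *s s + x2 *s f + x3 *s v + x4 *s t + (- 1) *s (B *v s) = 0"
    by simp
  from indep[OF this] have Bs: "B *v s = 0"
    by simp
  have Bf: "B *v f = 0"
  proof -
    have "q *s (B *v f) = 0"
      using Bs by (simp add: f_def flip: s_def CB)
    then show ?thesis
      using q_nonzero by simp
  qed
  \<comment> \<open>\<alpha> turns the eigenvalues into \<open>q^2, q, q, 1\<close>. The scaling of
    \<open>s'\<close> makes \<alpha> times \<open>B *v v\<close> equal to \<open>q *s s'\<close>,
    and \<mu> below is read off from \<open>q *s (B *v t) = f\<close>.\<close>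
  define \<alpha> where "\<alpha> = inverse m"
  define s' where "s' = (\<alpha> / q) *s s"
  have "\<alpha> \<noteq> 0"
    using \<open>m \<noteq> 0\<close> by (simp add: \<alpha>_def)
  have basis': "basis4 s' f v t"
  proof (rule basis4I)
    fix x1 x2 x3 x4 assume "x1 *s s' + x2 *s f + x3 *s v + x4 *s t = 0"
    then show "x1 = 0 \<and> x2 = 0 \<and> x3 = 0 \<and> x4 = 0"
      using indep[of "x1 * (\<alpha> / q)" x2 x3 x4 0] vf[of x2 x3] \<open>s \<noteq> 0\<close> \<open>t \<noteq> 0\<close> \<open>\<alpha> \<noteq> 0\<close> q_nonzero
      by (simp add: s'_def)
  qed
  define P where "P = (transpose (vector [s', f, v, t]) :: complex^4^4)"
  define \<mu> where "\<mu> = - \<alpha> / q"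
  have "\<mu> \<noteq> 0"
    using \<open>\<alpha> \<noteq> 0\<close> q_nonzero by (simp add: \<mu>_def)
  have "invertible P"
    using basis' by (simp add: basis4_def P_def)
  have 1: "diagonal (vector [q^2, q, q, 1]) = \<alpha> *\<^sub>C (matrix_inv P ** A ** P)"
    unfolding P_def
    by (rule basis4_conj[OF basis'])
      (use \<open>m \<noteq> 0\<close> in \<open>simp_all add: diagonal_def s'_def \<alpha>_def As Af Av At vec.scale power2_eq_square\<close>)
  have 2: "q *\<^sub>C matrix_unit 1 3 - \<mu> *\<^sub>C matrix_unit 2 4 = \<alpha> *\<^sub>C (matrix_inv P ** B ** P)"
    unfolding P_def
    by (rule basis4_conj[OF basis'])
      (use Bs Bf q_nonzero in \<open>simp_all add: matrix_unit_def axis_def s'_def \<mu>_def vec.scale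
        flip: s_def Bt\<close>)
  show ?thesis
    using form1_witness[OF q_nonzero \<open>\<mu> \<noteq> 0\<close>]
      equivalent_reps_conj[OF \<open>invertible P\<close> \<open>\<alpha> \<noteq> 0\<close>, of A B, folded 1 2]
    unfolding form1_def by blast
qed

text \<open>\<open>M = C ** B\<close> vanishes on every eigenvector of \<open>A\<close>, so a
  preimage under \<open>M\<close> of an eigenvector is never itself one. This forces a Jordan
  block.\<close>

lemma jordan_case:
  assumes kills_eigenvectors: "\<And>v l. A *v v = l *s v \<Longrightarrow> C *v (B *v v) = 0"
    and "C ** B \<noteq> 0"
  shows "\<exists>A\<^sub>0 B\<^sub>0 B'. spinor_rep q A\<^sub>0 B\<^sub>0 \<and> equivalent_reps (A, B) (A\<^sub>0, B\<^sub>0) \<and>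
    admissibility_witness q A\<^sub>0 B\<^sub>0 B' \<and> form3 q A\<^sub>0 B\<^sub>0 B'"
proof -
  define M where "M = C ** B"
  have M: "M *v v = C *v (B *v v)" for v
    by (simp add: M_def matrix_vector_mul_assoc)
  have AM: "A *v (M *v v) = M *v (A *v v)" for v
  proof -
    have "q *s (A *v (M *v v)) = q *s (M *v (A *v v))"
      by (simp add: M AB CA[symmetric] vec.scale)
    then show ?thesis
      using q_nonzero by (simp only: vec.scale_cancel_left) simp
  qed
  obtain v where "M *v v \<noteq> 0"
    using assms(2) unfolding M_def by (metis matrix_eq matrix_vector_mult_0)
  \<comment> \<open>The range of \<open>M\<close> is nonzero and, as \<open>M\<close> commutes with
    \<open>A\<close>, invariant.\<close>
  obtain l f where f: "f \<in> range ((*v) M)" "f \<noteq> 0" "A *v f = l *s f"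
  proof (rule eigenvector_in_subspace)
    show "vec.subspace (range ((*v) M))"
      by (simp add: vec.linear_subspace_image)
    show "A *v w \<in> range ((*v) M)" if "w \<in> range ((*v) M)" for w
      using that AM by auto
    show "M *v v \<in> range ((*v) M)" "M *v v \<noteq> 0"
      using \<open>M *v v \<noteq> 0\<close> by auto
  qed
  then obtain z where z: "f = M *v z"
    by auto
  define m where "m = l / q"
  have Af: "A *v f = (q * m) *s f"
    using f(3) q_nonzero by (simp add: m_def)
  have "m \<noteq> 0"
    using eigenvalue_nonzero[OF Af f(2)] by auto
  \<comment> \<open>\<open>C\<close> maps \<open>B *v z\<close> to the eigenvector \<open>f\<close>,
    which yields an eigenvector for \<open>q\<close> times its eigenvalue.\<close>
  obtain s where s: "s \<noteq> 0" "A *v s = (q * (q * m)) *s s"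
  proof (rule intertwined_eigenvalue[where A = A and X = C and k = q and s = "B *v z" and l = "q * m"])
    show "C *v (A *v v) = q *s (A *v (C *v v))" for v
      by (rule CA)
  qed (use f(2) Af in \<open>auto simp: z M\<close>)
  \<comment> \<open>The same with \<open>B\<close> and the factor \<open>inverse q\<close>:
    \<open>B\<close> maps \<open>C *v z\<close> to a nonzero multiple of \<open>f\<close>.\<close>
  obtain t where t: "t \<noteq> 0" "A *v t = m *s t"
  proof (rule intertwined_eigenvalue[where A = A and X = B and k = "inverse q" and s = "C *v z" and l = "q * m"])
    show "B *v (A *v v) = inverse q *s (A *v (B *v v))" for v
      using q_nonzero by (simp add: AB)
    have "B *v (C *v z) = inverse q *s f"
      using q_nonzero by (simp add: z M CB)
    then show "B *v (C *v z) \<noteq> 0" "A *v (B *v (C *v z)) = (q * m) *s (B *v (C *v z))"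
      using f(2) Af q_nonzero by (simp_all add: vec.scale mult.commute)
  qed (use q_nonzero in \<open>simp add: mult.assoc[symmetric]\<close>)
  have Mf: "M *v f = 0" and Ms: "M *v s = 0" and Mt: "M *v t = 0"
    using kills_eigenvectors Af s(2) t(2) unfolding M by blast+
  \<comment> \<open>Applying \<open>M\<close> isolates the coefficient of \<open>z\<close>; the
    other three vectors have distinct eigenvalues. The claim is kept general to serve again for the
    corrected \<open>z'\<close> and a rescaled \<open>f\<close>.\<close>
  have basis: "basis4 (a *s f) z s t" if "M *v z = f" "a \<noteq> 0" for z a
  proof (rule basis4I)
    fix x1 x2 x3 x4 assume eq: "x1 *s (a *s f) + x2 *s z + x3 *s s + x4 *s t = 0"
    then have "M *v (x1 *s (a *s f) + x2 *s z + x3 *s s + x4 *s t) = 0"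
      by simp
    then have "x2 *s f = 0"
      using that by (simp add: vec.add vec.scale Mf Ms Mt)
    then have "x2 = 0"
      using f(2) by simp
    have "\<forall>w \<in> set (map snd [(q * m, x1 *s (a *s f)), (q * (q * m), x3 *s s), (m, x4 *s t)]). w = 0"
    proof (rule sum_eigenvectors_eq_0[where A = A])
      show "A *v w = k *s w" if "(k, w) \<in> set [(q * m, x1 *s (a *s f)), (q * (q * m), x3 *s s), (m, x4 *s t)]"
        for k w
        using that Af s(2) t(2) by (auto simp: vec.scale mult_ac)
    qed (use eq \<open>x2 = 0\<close> distinct_eigenvalues[OF \<open>m \<noteq> 0\<close>] in \<open>auto simp: add.assoc\<close>)
    then show "x1 = 0 \<and> x2 = 0 \<and> x3 = 0 \<and> x4 = 0"
      using \<open>x2 = 0\<close> f(2) s(1) t(1) \<open>a \<noteq> 0\<close> by simp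
  qed
  have "basis4 f z s t"
    using basis[of z 1] z by simp
  then obtain a b c d where Az: "A *v z = a *s f + b *s z + c *s s + d *s t"
    by (rule basis4_expand)
  \<comment> \<open>Comparison of \<open>A *v (M *v z)\<close> with
    \<open>M *v (A *v z)\<close>.\<close>
  have "b = q * m"
  proof -
    have "(q * m) *s f = b *s f"
      using AM[of z] unfolding z[symmetric] Az Af by (simp add: vec.add vec.scale Mf Ms Mt flip: z)
    then show ?thesis
      using f(2) by (simp only: vec.scale_cancel_right) simp
  qed
  have ne: "q * m - q * (q * m) \<noteq> 0" "q * m - m \<noteq> 0"
    using distinct_eigenvalues[OF \<open>m \<noteq> 0\<close>] by auto
  txt \<open>The correction removes the components of \<open>A z\<close> along \<open>s\<close> and \<open>t\<close>.\<close>
  define z' where "z' = z + (c / (q * m - q * (q * m))) *s s + (d / (q * m - m)) *s t"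
  have Mz': "M *v z' = f"
    by (simp add: z'_def vec.add vec.scale Ms Mt z)
  have solve: "y + x / (k - r) * r = k * (x / (k - r))" if "x = y" "k - r \<noteq> 0" for x y k r :: complex
    using that by (simp add: field_simps)
  have Az': "A *v z' = a *s f + (q * m) *s z'"
  proof -
    have "A *v z' = a *s f + (q * m) *s z + (c + c / (q * m - q * (q * m)) * (q * (q * m))) *s s
        + (d + d / (q * m - m) * m) *s t"
      by (simp add: z'_def vec.add vec.scale Az s(2) t(2) \<open>b = q * m\<close> vec.scale_left_distrib add_ac)
    also have "\<dots> = a *s f + (q * m) *s z'"
      unfolding solve[OF refl ne(1)] solve[OF refl ne(2)]
      by (simp add: z'_def vec.scale_right_distrib add_ac)
    finally show ?thesis .
  qed
  \<comment> \<open>Otherwise \<open>z'\<close> would be an eigenvector of \<open>A\<close> not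
    killed by \<open>M\<close>.\<close>
  have "a \<noteq> 0"
  proof
    assume "a = 0"
    then have "M *v z' = 0"
      using kills_eigenvectors[of z' "q * m"] Az' by (simp add: M)
    then show False
      using Mz' f(2) by simp
  qed
  define \<alpha> where "\<alpha> = inverse m"
  have "\<alpha> \<noteq> 0"
    using \<open>m \<noteq> 0\<close> by (simp add: \<alpha>_def)
  \<comment> \<open>Scaling \<open>f\<close> by \<open>\<alpha> * a\<close> makes the off-diagonal
    entry of the Jordan block equal to 1.\<close>
  define P where "P = (transpose (vector [(\<alpha> * a) *s f, z', s, t]) :: complex^4^4)"
  have basis': "basis4 ((\<alpha> * a) *s f) z' s t"
    using Mz' \<open>a \<noteq> 0\<close> \<open>\<alpha> \<noteq> 0\<close> by (intro basis) auto
  have P: "invertible P"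
    using basis' by (simp add: basis4_def P_def)
  have J: "jordan_matrix q = \<alpha> *\<^sub>C (matrix_inv P ** A ** P)"
    unfolding P_def
    by (rule basis4_conj[OF basis'])
      (use \<open>m \<noteq> 0\<close> in \<open>simp_all add: jordan_matrix_def \<alpha>_def Af Az' s t vec.scale
        vec.scale_right_distrib power2_eq_square mult_ac\<close>)
  define B\<^sub>0 B' where "B\<^sub>0 = \<alpha> *\<^sub>C (matrix_inv P ** B ** P)" and "B' = \<alpha> *\<^sub>C (matrix_inv P ** C ** P)"
  \<comment> \<open>Here the witness is the conjugate of \<open>C\<close> itself, whose shape
    follows from \<open>spinor_rep_jordan'\<close>.\<close>
  have wit: "admissibility_witness q (jordan_matrix q) B\<^sub>0 B'"
    unfolding J B\<^sub>0_def B'_def using rep_CB rep_CA assms(2)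
    by (intro admissibility_witness_conj[OF P \<open>\<alpha> \<noteq> 0\<close>]) (simp add: admissibility_witness_def)
  have rep: "spinor_rep q (jordan_matrix q) B\<^sub>0"
    unfolding J B\<^sub>0_def by (rule spinor_rep_conj[OF P rep_AB])
  have "form3 q (jordan_matrix q) B\<^sub>0 B'"
    unfolding form3_def
    using spinor_rep_jordan[OF q_nonzero q2 q3 rep] spinor_rep_jordan'[OF q_nonzero q2 q3, of B'] wit
    by (auto simp: jordan_matrix_def admissibility_witness_def)
  then show ?thesis
    using rep wit equivalent_reps_conj[OF P \<open>\<alpha> \<noteq> 0\<close>, of A B, folded J B\<^sub>0_def] by blast
qed

end

theorem theorem1:
  fixes q :: complex and A B :: "complex^4^4"
  assumes "q \<noteq> 0" and "q^3 \<noteq> 1" and "q^4 \<noteq> 1"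
    and "admissible q A B" and "invertible A"
  shows "\<exists>A\<^sub>0 B\<^sub>0 B'.
           spinor_rep q A\<^sub>0 B\<^sub>0 \<and>
           equivalent_reps (A, B) (A\<^sub>0, B\<^sub>0) \<and>
           admissibility_witness q A\<^sub>0 B\<^sub>0 B' \<and>
           (form1 q A\<^sub>0 B\<^sub>0 B' \<or> form2 q A\<^sub>0 B\<^sub>0 B' \<or> form3 q A\<^sub>0 B\<^sub>0 B')"
proof -
  obtain C where C: "spinor_rep q C B" "spinor_rep q C A" "C ** B \<noteq> 0"
    using assms(4) by (auto simp: admissible_def admissibility_witness_def)
  interpret spinor_triple q A B C
    using assms C by unfold_locales (auto simp: admissible_def)
  \<comment> \<open>Either \<open>C ** B\<close> is nonzero on some eigenvector of \<open>A\<close>,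
    or it kills them all.\<close>
  show ?thesis
    using diagonalizable_case jordan_case[OF _ C(3)] by blast
qed

end
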